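(* For all integers $n\geq 2$, we have $$|S_n^{(2)}(132:231)|=|S_n^{(2)}(213:312)|=2^{n-1}.$$
   Context: $S_n$ denotes the set of permutations $p=p(1)p(2)\cdots p(n)$ of $\{1,2,\ldots,n\}$ in one-line notation. For $p\in S_n$ and $q\in S_m$, $p$ contains $q$ as a pattern if there exist $1\leq i_1<\cdots<i_m\leq n$ such that for all $1\leq a<b\leq m$, $p(i_a)<p(i_b)$ if and only if $q(a)<q(b)$; otherwise $p$ avoids $q$. For $p\in S_n$ with $n\geq 2$, $p^{(2)}=p(2)p(3)\cdots p(n)p(1)$. For $q_1,q_2\in S_3$, $S_n^{(2)}(q_1:q_2)$ is the set of $p\in S_n$ such that $p$ avoids $q_1$ and $p^{(2)}$ avoids $q_2$. *)

theory Defs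
  imports "HOL-Combinatorics.Multiset_Permutations"
begin

text \<open>
  A permutation in \<open>S\<^sub>n\<close> is represented by its one-line notation, a list of length \<open>n\<close>
  enumerating \<open>{1..n}\<close> without repetition. The values are \<open>1, \<dots>, n\<close>, but list positions
  count from \<open>0\<close>: \<open>p(i)\<close> is \<open>p ! (i - 1)\<close>.
\<close>

definition perms :: "nat \<Rightarrow> nat list set" where
  "perms n = permutations_of_set {1..n}"

text \<open>\<open>f a\<close> is the position in \<open>p\<close> of the \<open>a\<close>-th entry of the occurrence of \<open>q\<close>.\<close>

definition contains :: "nat list \<Rightarrow> nat list \<Rightarrow> bool" where
  "contains p q \<longleftrightarrow>
     (\<exists>f. strict_mono_on {..<length q} f \<and> f ` {..<length q} \<subseteq> {..<length p} \<and>
        (\<forall>a b. a < b \<and> b < length q \<longrightarrow> (p ! f a < p ! f b \<longleftrightarrow> q ! a < q ! b)))"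

abbreviation avoids :: "nat list \<Rightarrow> nat list \<Rightarrow> bool" where
  "avoids p q \<equiv> \<not> contains p q"

text \<open>\<open>p\<^sup>(\<^sup>2\<^sup>) = p(2) p(3) \<dots> p(n) p(1)\<close> is the library's \<open>rotate1 p\<close>.\<close>

definition S2 :: "nat \<Rightarrow> nat list \<Rightarrow> nat list \<Rightarrow> nat list set" where
  "S2 n q1 q2 = {p \<in> perms n. avoids p q1 \<and> avoids (rotate1 p) q2}"

end

theory Submission
  imports Defs "HOL-Library.Sublist"
begin

text \<open>
  Write \<open>p = k p'\<close>, so that \<open>p\<^sup>(\<^sup>2\<^sup>) = p' k\<close>. For \<open>132 : 231\<close>, the occurrences that use \<open>k\<close> are
  excluded iff the entries of \<open>p'\<close> above \<open>k\<close> are both increasing and decreasing, so iff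
  \<open>k \<in> {n - 1, n}\<close>; those inside \<open>p'\<close> are excluded iff no entry has smaller entries on both
  sides. For \<open>213 : 312\<close> the entry \<open>k\<close> must be an extreme value, and \<open>p'\<close> satisfies the same
  condition for the reversed order. In a permutation without such peaks the maximum is first or
  last, so there are \<open>2\<^bsup>n - 2\<^esup>\<close> choices for \<open>p'\<close>.
\<close>

section \<open>Subsequences of length two and three\<close>

lemma subseq_Cons_iff_nth:
  "subseq (x # xs) p \<longleftrightarrow> (\<exists>i<length p. p ! i = x \<and> subseq xs (drop (Suc i) p))"
proof
  assume "subseq (x # xs) p"
  then obtain us vs where "p = us @ x # vs" "subseq xs vs"
    using list_emb_ConsD[of "(=)" x xs p] by auto
  then show "\<exists>i<length p. p ! i = x \<and> subseq xs (drop (Suc i) p)"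
    by (intro exI[of _ "length us"]) auto
next
  assume "\<exists>i<length p. p ! i = x \<and> subseq xs (drop (Suc i) p)"
  then obtain i where i: "i < length p" "p ! i = x" "subseq xs (drop (Suc i) p)"
    by blast
  then have "subseq (x # xs) (take i p @ x # drop (Suc i) p)"
    by (intro list_emb_append2) simp
  with i show "subseq (x # xs) p"
    using id_take_nth_drop[OF i(1)] by simp
qed

text \<open>Links the positions that \<open>contains\<close> speaks of with the library's
  \<open>subseq\<close>, so that later arguments can be about values only.\<close>

lemma subseq3_iff_nth:
  "subseq [x, y, z] p \<longleftrightarrow>
    (\<exists>i j k. i < j \<and> j < k \<and> k < length p \<and> p ! i = x \<and> p ! j = y \<and> p ! k = z)"
proof
  assume "subseq [x, y, z] p"
  \<comment> \<open>Each \<open>drop\<close> restarts the count of positions, so \<open>j\<close>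
    and \<open>k\<close> are offsets from the position just after the previous entry.\<close>
  then obtain i j k where "i < length p" "p ! i = x" "j < length p - Suc i" "p ! (Suc i + j) = y"
    "k < length p - Suc i - Suc j" "p ! (Suc i + (Suc j + k)) = z"
    unfolding subseq_Cons_iff_nth length_drop by (fastforce simp: ac_simps)
  then show "\<exists>i j k. i < j \<and> j < k \<and> k < length p \<and> p ! i = x \<and> p ! j = y \<and> p ! k = z"
    by (intro exI[of _ i] exI[of _ "Suc i + j"] exI[of _ "Suc i + (Suc j + k)"]) auto
next
  assume "\<exists>i j k. i < j \<and> j < k \<and> k < length p \<and> p ! i = x \<and> p ! j = y \<and> p ! k = z"
  then obtain i j k where *: "i < j" "j < k" "k < length p" "p ! i = x" "p ! j = y" "p ! k = z"
    by blast
  have "subseq [z] (drop (Suc j) p)"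
    unfolding subseq_Cons_iff_nth using * by (intro exI[of _ "k - Suc j"]) auto
  then have "subseq [y, z] (drop (Suc i) p)"
    unfolding subseq_Cons_iff_nth[of y] using * by (intro exI[of _ "j - Suc i"]) auto
  then show "subseq [x, y, z] p"
    unfolding subseq_Cons_iff_nth[of x] using * by (intro exI[of _ i]) auto
qed

lemma subseq2_in_set:
  assumes "subseq [x, y] p"
  shows "x \<in> set p" "y \<in> set p"
  using list_emb_set[OF assms, of x] list_emb_set[OF assms, of y] by auto

lemma distinct_subseq: "distinct p \<Longrightarrow> subseq xs p \<Longrightarrow> distinct xs"
  by (auto simp: subseq_conv_nths)

text \<open>\<open>k # p\<close> and its rotation \<open>p @ [k]\<close> share the part
  \<open>p\<close>. This lemma and the next separate the occurrences inside \<open>p\<close> from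
  those in which \<open>k\<close> is the first or the last entry.\<close>

lemma subseq3_Cons:
  "subseq [x, y, z] (k # p) \<longleftrightarrow> subseq [x, y, z] p \<or> x = k \<and> subseq [y, z] p"
  by (metis subseq_Cons2_iff list_emb_Cons)

lemma subseq3_snoc:
  "subseq [x, y, z] (p @ [k]) \<longleftrightarrow> subseq [x, y, z] p \<or> z = k \<and> subseq [x, y] p"
proof -
  \<comment> \<open>Writing the triple as an append makes the library's rules for
    \<open>subseq\<close> and \<open>@\<close> applicable.\<close>
  have "subseq ([x, y] @ [z]) (p @ [k]) \<longleftrightarrow> subseq ([x, y] @ [z]) p \<or> z = k \<and> subseq [x, y] p"
  proof
    assume "subseq ([x, y] @ [z]) (p @ [k])"
    then show "subseq ([x, y] @ [z]) p \<or> z = k \<and> subseq [x, y] p"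
      unfolding subseq_append_iff by (auto simp: append_eq_Cons_conv Cons_eq_append_conv split: if_splits)
  next
    assume "subseq ([x, y] @ [z]) p \<or> z = k \<and> subseq [x, y] p"
    then show "subseq ([x, y] @ [z]) (p @ [k])"
      by (elim disjE) (blast, intro list_emb_append_mono, auto)
  qed
  then show ?thesis by simp
qed

lemma distinct_subseq2:
  assumes "distinct p" "x \<in> set p" "y \<in> set p" "x \<noteq> y"
  shows "subseq [x, y] p \<or> subseq [y, x] p"
  using assms by (induction p) (auto simp: subseq_singleton_left)

section \<open>Patterns of length three in terms of values\<close>

lemma contains3_iff_subseq:
  "contains p [a, b, c] \<longleftrightarrow>
    (\<exists>x y z. subseq [x, y, z] p \<and> (x < y \<longleftrightarrow> a < b) \<and> (x < z \<longleftrightarrow> a < c) \<and> (y < z \<longleftrightarrow> b < c))"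
proof
  assume "contains p [a, b, c]"
  then obtain f :: "nat \<Rightarrow> nat" where f: "strict_mono_on {..<3} f" "f ` {..<3} \<subseteq> {..<length p}"
      "\<And>i j. i < j \<Longrightarrow> j < 3 \<Longrightarrow> p ! f i < p ! f j \<longleftrightarrow> [a, b, c] ! i < [a, b, c] ! j"
    by (auto simp: contains_def numeral_3_eq_3)
  have "f 0 < f 1" "f 1 < f 2" "f 2 < length p"
    using f(2) by (auto simp: image_subset_iff intro!: strict_mono_onD[OF f(1)])
  then have "subseq [p ! f 0, p ! f 1, p ! f 2] p"
    unfolding subseq3_iff_nth by blast
  with f(3)[of 0 1] f(3)[of 0 2] f(3)[of 1 2]
  show "\<exists>x y z. subseq [x, y, z] p \<and> (x < y \<longleftrightarrow> a < b) \<and> (x < z \<longleftrightarrow> a < c) \<and> (y < z \<longleftrightarrow> b < c)"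
    by (intro exI[of _ "p ! f 0"] exI[of _ "p ! f 1"] exI[of _ "p ! f 2"]) simp
next
  assume "\<exists>x y z. subseq [x, y, z] p \<and> (x < y \<longleftrightarrow> a < b) \<and> (x < z \<longleftrightarrow> a < c) \<and> (y < z \<longleftrightarrow> b < c)"
  then obtain i j k where *: "i < j" "j < k" "k < length p" "p ! i < p ! j \<longleftrightarrow> a < b"
      "p ! i < p ! k \<longleftrightarrow> a < c" "p ! j < p ! k \<longleftrightarrow> b < c"
    unfolding subseq3_iff_nth by blast
  let ?f = "\<lambda>l. [i, j, k] ! l"
  have three: "l = 0 \<or> l = 1 \<or> l = 2" if "l < 3" for l :: nat
    using that by auto
  have "strict_mono_on {..<3} ?f"
    using * by (auto simp: strict_mono_on_def dest!: three)
  moreover have "?f ` {..<3} \<subseteq> {..<length p}"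
    using * by (auto dest!: three)
  moreover have "p ! ?f l < p ! ?f m \<longleftrightarrow> [a, b, c] ! l < [a, b, c] ! m"
    if "l < m" "m < 3" for l m
  proof -
    from that consider "l = 0" "m = 1" | "l = 0" "m = 2" | "l = 1" "m = 2"
      using three[of l] three[of m] by linarith
    then show ?thesis
      using * by cases simp_all
  qed
  ultimately show "contains p [a, b, c]"
    unfolding contains_def by (intro exI[of _ ?f]) (auto simp: numeral_3_eq_3)
qed

text \<open>Entries of a subsequence of \<open>p\<close> are distinct, so a failing \<open><\<close>
  is a reversed \<open><\<close>, and the three equivalences collapse to a chain of two
  inequalities.\<close>

lemma contains3_distinct_iff:
  assumes "distinct p"
  shows "contains p [1,3,2] \<longleftrightarrow> (\<exists>x y z. subseq [x, y, z] p \<and> x < z \<and> z < y)"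
    and "contains p [2,3,1] \<longleftrightarrow> (\<exists>x y z. subseq [x, y, z] p \<and> z < x \<and> x < y)"
    and "contains p [2,1,3] \<longleftrightarrow> (\<exists>x y z. subseq [x, y, z] p \<and> y < x \<and> x < z)"
    and "contains p [3,1,2] \<longleftrightarrow> (\<exists>x y z. subseq [x, y, z] p \<and> y < z \<and> z < x)"
  unfolding contains3_iff_subseq
  by (intro ex_cong1, rule conj_cong[OF refl], drule distinct_subseq[OF assms], simp, arith)+

section \<open>Lists without peaks and their number\<close>

text \<open>The three entries need not be adjacent. The relation is a parameter because
  \<open>(>)\<close> turns peaks into valleys, which is what the second pair of patterns
  requires.\<close>

definition peakfree :: "('a \<Rightarrow> 'a \<Rightarrow> bool) \<Rightarrow> 'a list \<Rightarrow> bool" where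
  "peakfree R p \<longleftrightarrow> (\<forall>x y z. subseq [x, y, z] p \<longrightarrow> \<not> (R x y \<and> R z y))"

text \<open>A new first entry can only be the left side of a peak, and for that it would have to lie
  below some entry of \<open>p\<close>.\<close>

lemma peakfree_Cons_greatest:
  assumes "\<And>x. x \<in> set p \<Longrightarrow> \<not> R m x"
  shows "peakfree R (m # p) \<longleftrightarrow> peakfree R p"
proof -
  have "\<not> R m y" if "subseq [y, z] p" for y z
    using assms subseq2_in_set(1)[OF that] .
  then show ?thesis
    unfolding peakfree_def subseq3_Cons by metis
qed

lemma peakfree_snoc_greatest:
  assumes "\<And>x. x \<in> set p \<Longrightarrow> \<not> R m x"
  shows "peakfree R (p @ [m]) \<longleftrightarrow> peakfree R p"
proof -
  have "\<not> R m y" if "subseq [x, y] p" for x y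
    using assms subseq2_in_set(2)[OF that] .
  then show ?thesis
    unfolding peakfree_def subseq3_snoc by metis
qed

text \<open>With an entry on either side, \<open>m\<close> would be the top of a peak.\<close>

lemma peakfree_greatest_at_end:
  assumes "peakfree R (us @ m # vs)" "\<And>x. x \<in> set us \<union> set vs \<Longrightarrow> R x m"
  shows "us = [] \<or> vs = []"
proof (rule ccontr)
  assume "\<not> (us = [] \<or> vs = [])"
  then have hd: "hd us \<in> set us" "hd vs \<in> set vs"
    by auto
  then have "subseq ([hd us] @ [m, hd vs]) (us @ m # vs)"
    by (intro list_emb_append_mono) (auto simp: subseq_singleton_left)
  with hd assms show False
    by (auto simp: peakfree_def)
qed

lemma finite_peakfree [simp]: "finite {p \<in> permutations_of_set A. peakfree R p}"
  by (rule finite_subset[of _ "permutations_of_set A"]) auto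

text \<open>Induction by removing the greatest element: it stands at one of the two ends, and
  putting it back at either end creates no peak, so each new element doubles the count. The base is
  a singleton, where both ends give the same list.\<close>

lemma card_peakfree:
  assumes "card A = Suc n" "asymp_on A R" "transp_on A R" "totalp_on A R"
  shows "card {p \<in> permutations_of_set A. peakfree R p} = 2 ^ n"
  using assms
proof (induction n arbitrary: A)
  case 0
  then obtain a where "A = {a}"
    by (auto simp: card_1_singleton_iff)
  then have "{p \<in> permutations_of_set A. peakfree R p} = {[a]}"
    by (auto simp: peakfree_def split: if_splits)
  then show ?case by simp
next
  case (Suc n)
  let ?P = "\<lambda>A. {p \<in> permutations_of_set A. peakfree R p}"
  have "finite A" "A \<noteq> {}"
    using Suc.prems(1) card.infinite by force+
  with Suc.prems obtain m where m: "m \<in> A" "\<And>x. x \<in> A \<Longrightarrow> x \<noteq> m \<Longrightarrow> R x m"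
    by (metis Finite_Set.bex_greatest_element)
  have max: "\<not> R m x" if "x \<in> A" for x
    using m that Suc.prems(2) by (metis asymp_onD)
  have ends: "peakfree R (m # p) \<longleftrightarrow> peakfree R p" "peakfree R (p @ [m]) \<longleftrightarrow> peakfree R p"
    if "set p \<subseteq> A" for p
    using max that by (meson peakfree_Cons_greatest peakfree_snoc_greatest subsetD)+
  let ?B = "A - {m}"
  have cardB: "card ?B = Suc n"
    using Suc.prems(1) m(1) by simp
  have IH: "card (?P ?B) = 2 ^ n"
    using Suc.prems cardB
    by (intro Suc.IH) (auto intro: asymp_on_subset transp_on_subset totalp_on_subset)
  have "?P A = Cons m ` ?P ?B \<union> (\<lambda>p. p @ [m]) ` ?P ?B"
  proof (intro equalityI subsetI)
    fix p assume p: "p \<in> ?P A"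
    with m(1) obtain us vs where us: "p = us @ m # vs"
      by (auto simp: permutations_of_set_def dest: split_list)
    with p have d: "set us \<union> set vs = ?B" "distinct (us @ vs)"
      by (auto simp: permutations_of_set_def)
    with m p us have "us = [] \<or> vs = []"
      by (intro peakfree_greatest_at_end[of R us m vs]) auto
    then show "p \<in> Cons m ` ?P ?B \<union> (\<lambda>p. p @ [m]) ` ?P ?B"
    proof
      assume "us = []"
      with d us p ends(1)[of vs] have "p = m # vs" "vs \<in> ?P ?B"
        by (simp_all add: permutations_of_set_def)
      then show ?thesis by blast
    next
      assume "vs = []"
      with d us p ends(2)[of us] have "p = us @ [m]" "us \<in> ?P ?B"
        by (simp_all add: permutations_of_set_def)
      then show ?thesis by blast
    qed
  next
    fix p assume "p \<in> Cons m ` ?P ?B \<union> (\<lambda>p. p @ [m]) ` ?P ?B"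
    then obtain q where q: "q \<in> ?P ?B" "p = m # q \<or> p = q @ [m]"
      by blast
    from q(1) have B: "set q = ?B" "distinct q" "peakfree R q"
      by (simp_all add: permutations_of_set_def)
    then have "set q \<subseteq> A" "insert m (set q) = A" "m \<notin> set q"
      using m(1) by auto
    with q(2) B(2,3) ends[of q] show "p \<in> ?P A"
      by (elim disjE) (simp_all add: permutations_of_set_def)
  qed
  moreover have "Cons m ` ?P ?B \<inter> (\<lambda>p. p @ [m]) ` ?P ?B = {}"
  proof -
    \<comment> \<open>As \<open>?B\<close> is nonempty, so is \<open>q\<close>; the last entry
      \<open>m\<close> of \<open>q @ [m]\<close> would then lie in \<open>p\<close>, which avoids
      \<open>m\<close>.\<close>
    have False if "m # p = q @ [m]" "p \<in> ?P ?B" "q \<in> ?P ?B" for p q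
    proof -
      have "card (set q) = Suc n" "m \<notin> set p"
        using that(2,3) cardB by (simp_all add: permutations_of_set_def)
      with that(1) show False
        by (cases q) auto
    qed
    then show ?thesis by blast
  qed
  moreover have "card (Cons m ` ?P ?B) = 2 ^ n" "card ((\<lambda>p. p @ [m]) ` ?P ?B) = 2 ^ n"
    using IH by (simp_all add: card_image inj_on_def)
  ultimately show ?case
    by (simp add: card_Un_disjoint)
qed

section \<open>From tails without peaks to the two pattern pairs\<close>

text \<open>The common count for both pairs: \<open>K\<close> holds the two admissible first
  entries, and after each of them the \<open>n - 1\<close> remaining values can be arranged in
  \<open>2 ^ (n - 2)\<close> ways.\<close>

lemma card_Cons_peakfree:
  fixes R :: "nat \<Rightarrow> nat \<Rightarrow> bool"
  assumes "n \<ge> 2" "asymp R" "transp R" "totalp R"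
    and K: "K \<subseteq> {1..n}" "card K = 2"
    and S: "\<And>k p. k # p \<in> perms n \<Longrightarrow> k # p \<in> S \<longleftrightarrow> k \<in> K \<and> peakfree R p"
    and sub: "S \<subseteq> perms n"
  shows "card S = 2 ^ (n - 1)"
proof -
  let ?P = "\<lambda>k. {p \<in> permutations_of_set ({1..n} - {k}). peakfree R p}"
  have perms_Cons: "k # p \<in> perms n \<longleftrightarrow> k \<in> {1..n} \<and> p \<in> permutations_of_set ({1..n} - {k})" for k p
  proof -
    have "insert k B = A \<and> k \<notin> B \<longleftrightarrow> k \<in> A \<and> B = A - {k}" for A B :: "nat set"
      by blast
    from this[of "set p" "{1..n}"] show ?thesis
      unfolding perms_def permutations_of_set_def mem_Collect_eq distinct.simps list.set by argo
  qed
  have "S = (\<lambda>(k, p). k # p) ` (SIGMA k:K. ?P k)"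
  proof (intro equalityI subsetI)
    fix q assume q: "q \<in> S"
    with sub have "q \<in> perms n" by blast
    with assms(1) obtain k p where "q = k # p"
      by (cases q) (auto simp: perms_def permutations_of_set_def)
    with q \<open>q \<in> perms n\<close> S[of k p] perms_Cons[of k p]
    show "q \<in> (\<lambda>(k, p). k # p) ` (SIGMA k:K. ?P k)"
      by (auto simp: image_iff)
  next
    fix q assume "q \<in> (\<lambda>(k, p). k # p) ` (SIGMA k:K. ?P k)"
    then obtain k p where "q = k # p" "k \<in> K" "p \<in> permutations_of_set ({1..n} - {k})" "peakfree R p"
      by auto
    with K(1) S[of k p] perms_Cons[of k p] show "q \<in> S"
      by auto
  qed
  moreover have "inj_on (\<lambda>(k, p). k # p) (SIGMA k:K. ?P k)"
    by (auto simp: inj_on_def)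
  moreover have "finite K"
    using K(1) finite_subset by blast
  moreover have "card (?P k) = 2 ^ (n - 2)" if "k \<in> K" for k
  proof (rule card_peakfree)
    show "card ({1..n} - {k}) = Suc (n - 2)"
      using that K(1) assms(1) by (subst card_Diff_singleton) auto
  qed (use assms in \<open>auto intro: asymp_on_subset transp_on_subset totalp_on_subset\<close>)
  ultimately have "card S = 2 * 2 ^ (n - 2)"
    using K(2) by (simp add: card_image card_SigmaI)
  also have "\<dots> = 2 ^ (n - 1)"
    using assms(1) by (cases n) (auto simp: power_eq_if)
  finally show ?thesis .
qed

text \<open>The entry \<open>k\<close> plays the smallest value in both patterns: as the 1 of 132 in
  front, as the 1 of 231 at the rear.\<close>

lemma Cons_in_S2_132_231:
  assumes "k # p \<in> perms n"
  shows "k # p \<in> S2 n [1,3,2] [2,3,1] \<longleftrightarrow> k \<in> {n - 1, n} \<and> peakfree (<) p"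
proof -
  have d: "distinct p" "k \<notin> set p" "insert k (set p) = {1..n}"
    using assms by (simp_all add: perms_def permutations_of_set_def)
  then have mem: "x \<in> set p \<longleftrightarrow> 1 \<le> x \<and> x \<le> n \<and> x \<noteq> k" and k: "1 \<le> k" "k \<le> n" for x
    by (auto simp: set_eq_iff)
  have neq: "x \<noteq> y \<and> x \<in> set p \<and> y \<in> set p" if "subseq [x, y] p" for x y
    using distinct_subseq[OF d(1) that] subseq2_in_set[OF that] by simp
  have K: "k \<in> {n - 1, n} \<longleftrightarrow> (\<forall>x y. subseq [x, y] p \<longrightarrow> \<not> (k < x \<and> k < y))"
  proof
    assume "k \<in> {n - 1, n}"
    then show "\<forall>x y. subseq [x, y] p \<longrightarrow> \<not> (k < x \<and> k < y)"
      using neq unfolding mem by fastforce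
  next
    assume *: "\<forall>x y. subseq [x, y] p \<longrightarrow> \<not> (k < x \<and> k < y)"
    show "k \<in> {n - 1, n}"
    proof (rule ccontr)
      assume "k \<notin> {n - 1, n}"
      \<comment> \<open>Both \<open>n - 1\<close> and \<open>n\<close> exceed \<open>k\<close> and
        so lie in \<open>p\<close>; whichever comes first, they form a forbidden pair.\<close>
      with k have "k < n - 1" "n - 1 \<in> set p" "n \<in> set p" "n - 1 \<noteq> n"
        unfolding mem by auto
      then have "k < n - 1" "k < n" "subseq [n - 1, n] p \<or> subseq [n, n - 1] p"
        using distinct_subseq2[OF d(1)] by simp_all
      with * show False by metis
    qed
  qed
  have dk: "distinct (k # p)" "distinct (p @ [k])"
    using d by simp_all
  \<comment> \<open>A peak is a 132 or a 231, depending on which of its sides is lower. The front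
    condition excludes the first kind inside \<open>p\<close>, the rear condition the
    second.\<close>
  have peak: "x < y \<and> z < y \<longleftrightarrow> x < z \<and> z < y \<or> z < x \<and> x < y"
    if "subseq [x, y, z] p" for x y z
    using distinct_subseq[OF d(1) that] by auto
  then have pf: "peakfree (<) p \<longleftrightarrow>
      (\<forall>x y z. subseq [x, y, z] p \<longrightarrow> \<not> (x < z \<and> z < y) \<and> \<not> (z < x \<and> x < y))"
    unfolding peakfree_def by simp
  have front: "avoids (k # p) [1,3,2] \<longleftrightarrow>
      (\<forall>x y z. subseq [x, y, z] p \<longrightarrow> \<not> (x < z \<and> z < y))
      \<and> (\<forall>x y. subseq [x, y] p \<longrightarrow> \<not> (k < y \<and> y < x))"
    unfolding contains3_distinct_iff[OF dk(1)] subseq3_Cons by metis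
  have rear: "avoids (p @ [k]) [2,3,1] \<longleftrightarrow>
      (\<forall>x y z. subseq [x, y, z] p \<longrightarrow> \<not> (z < x \<and> x < y))
      \<and> (\<forall>x y. subseq [x, y] p \<longrightarrow> \<not> (k < x \<and> x < y))"
    unfolding contains3_distinct_iff[OF dk(2)] subseq3_snoc by metis
  \<comment> \<open>Two entries above \<open>k\<close> complete a 132 with \<open>k\<close> in front
    if they descend, and a 231 with \<open>k\<close> at the rear if they ascend.\<close>
  have "k < x \<and> k < y \<longleftrightarrow> k < y \<and> y < x \<or> k < x \<and> x < y" if "subseq [x, y] p" for x y
    using distinct_subseq[OF d(1) that] by auto
  then have "k \<in> {n - 1, n} \<longleftrightarrow>
      (\<forall>x y. subseq [x, y] p \<longrightarrow> \<not> (k < y \<and> y < x) \<and> \<not> (k < x \<and> x < y))"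
    unfolding K by simp
  with front rear pf assms show ?thesis
    unfolding S2_def rotate1.simps mem_Collect_eq by meson
qed

text \<open>Here \<open>k\<close> plays the middle value 2 in both patterns, so no two entries of
  \<open>p\<close> may lie on different sides of \<open>k\<close>, in either order.\<close>

lemma Cons_in_S2_213_312:
  assumes "k # p \<in> perms n"
  shows "k # p \<in> S2 n [2,1,3] [3,1,2] \<longleftrightarrow> k \<in> {1, n} \<and> peakfree (>) p"
proof -
  have d: "distinct p" "k \<notin> set p" "insert k (set p) = {1..n}"
    using assms by (simp_all add: perms_def permutations_of_set_def)
  then have mem: "x \<in> set p \<longleftrightarrow> 1 \<le> x \<and> x \<le> n \<and> x \<noteq> k" and k: "1 \<le> k" "k \<le> n" for x
    by (auto simp: set_eq_iff)
  have neq: "x \<noteq> y \<and> x \<in> set p \<and> y \<in> set p" if "subseq [x, y] p" for x y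
    using distinct_subseq[OF d(1) that] subseq2_in_set[OF that] by simp
  have K: "k \<in> {1, n} \<longleftrightarrow>
      (\<forall>x y. subseq [x, y] p \<longrightarrow> \<not> (x < k \<and> k < y) \<and> \<not> (y < k \<and> k < x))"
  proof
    assume "k \<in> {1, n}"
    then show "\<forall>x y. subseq [x, y] p \<longrightarrow> \<not> (x < k \<and> k < y) \<and> \<not> (y < k \<and> k < x)"
      using neq unfolding mem by fastforce
  next
    assume *: "\<forall>x y. subseq [x, y] p \<longrightarrow> \<not> (x < k \<and> k < y) \<and> \<not> (y < k \<and> k < x)"
    show "k \<in> {1, n}"
    proof (rule ccontr)
      assume "k \<notin> {1, n}"
      \<comment> \<open>The extreme values \<open>1\<close> and \<open>n\<close> both occur in
        \<open>p\<close> and lie on different sides of \<open>k\<close>.\<close>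
      with k have "1 < k" "k < n" "1 \<in> set p" "n \<in> set p" "1 \<noteq> n"
        unfolding mem by auto
      then have "1 < k" "k < n" "subseq [1, n] p \<or> subseq [n, 1] p"
        using distinct_subseq2[OF d(1)] by simp_all
      with * show False by metis
    qed
  qed
  have dk: "distinct (k # p)" "distinct (p @ [k])"
    using d by simp_all
  have peak: "y < x \<and> y < z \<longleftrightarrow> y < x \<and> x < z \<or> y < z \<and> z < x"
    if "subseq [x, y, z] p" for x y z
    using distinct_subseq[OF d(1) that] by auto
  then have pf: "peakfree (>) p \<longleftrightarrow>
      (\<forall>x y z. subseq [x, y, z] p \<longrightarrow> \<not> (y < x \<and> x < z) \<and> \<not> (y < z \<and> z < x))"
    unfolding peakfree_def by simp
  have front: "avoids (k # p) [2,1,3] \<longleftrightarrow>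
      (\<forall>x y z. subseq [x, y, z] p \<longrightarrow> \<not> (y < x \<and> x < z))
      \<and> (\<forall>x y. subseq [x, y] p \<longrightarrow> \<not> (x < k \<and> k < y))"
    unfolding contains3_distinct_iff[OF dk(1)] subseq3_Cons by metis
  have rear: "avoids (p @ [k]) [3,1,2] \<longleftrightarrow>
      (\<forall>x y z. subseq [x, y, z] p \<longrightarrow> \<not> (y < z \<and> z < x))
      \<and> (\<forall>x y. subseq [x, y] p \<longrightarrow> \<not> (y < k \<and> k < x))"
    unfolding contains3_distinct_iff[OF dk(2)] subseq3_snoc by metis
  with front rear pf K assms show ?thesis
    unfolding S2_def rotate1.simps mem_Collect_eq by meson
qed

theorem proposition5p4:
  fixes n :: nat
  assumes "n \<ge> 2"
  shows "card (S2 n [1,3,2] [2,3,1]) = card (S2 n [2,1,3] [3,1,2]) \<and>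
         card (S2 n [2,1,3] [3,1,2]) = 2 ^ (n - 1)"
proof -
  \<comment> \<open>From \<open>n \<ge> 2\<close> it follows that \<open>n - 1\<close> is positive
    and \<open>1\<close> differs from \<open>n\<close>, so both choices of \<open>K\<close> are
    two-element subsets of \<open>{1..n}\<close>.\<close>
  have "card (S2 n [1,3,2] [2,3,1]) = 2 ^ (n - 1)"
    using assms Cons_in_S2_132_231
    by (intro card_Cons_peakfree[where R = "(<)" and K = "{n - 1, n}"]) (auto simp: S2_def)
  moreover have "card (S2 n [2,1,3] [3,1,2]) = 2 ^ (n - 1)"
    using assms Cons_in_S2_213_312
    by (intro card_Cons_peakfree[where R = "(>)" and K = "{1, n}"]) (auto simp: S2_def)
  ultimately show ?thesis by simp
qed

end
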